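(* Let $p$ be a prime and let $L$ be a locally compact abelian group of exponent $p$ (every non-identity element has order $p$). If $\nabla$ is a symplectic self-duality of $L$, then $(L,\nabla)$ is standard.
   Context: $\mathbf T=\mathbf R/\mathbf Z$; $\hat L$ is the Pontryagin dual of $L$ (continuous homomorphisms $L\to\mathbf T$, compact-open topology). A symplectic self-duality of $L$ is an isomorphism of topological groups $\nabla:L\to\hat L$ with $\nabla(x)(x)=0$ for all $x\in L$. For an LCA group $A$, the standard symplectic self-duality of $A\times\hat A$ is $\nabla^0(x,\chi)(y,\lambda)=\chi(y)-\lambda(x)$. $(L,\nabla)$ is standard if there exist an LCA group $A$ and an isomorphism of topological groups $\phi:A\times\hat A\to L$ with $\nabla(\phi(u))(\phi(v))=\nabla^0(u)(v)$ for all $u,v\in A\times\hat A$. *)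

theory Defs
  imports "HOL-Analysis.Analysis" "HOL-Algebra.Group"
begin

record 'a tgroup = "'a monoid" + gtop :: "'a topology"

definition LCA :: "('a, 'b) tgroup_scheme \<Rightarrow> bool" where
  "LCA G \<longleftrightarrow> comm_group G \<and> topspace (gtop G) = carrier G \<and>
     continuous_map (prod_topology (gtop G) (gtop G)) (gtop G) (\<lambda>(x, y). x \<otimes>\<^bsub>G\<^esub> y) \<and>
     continuous_map (gtop G) (gtop G) (\<lambda>x. inv\<^bsub>G\<^esub> x) \<and>
     Hausdorff_space (gtop G) \<and> locally_compact_space (gtop G)"

text \<open>The circle group T = R/Z, realised (via t \<mapsto> exp(2 pi i t)) as the unit circle in C
  under multiplication; the neutral element 0 of R/Z corresponds to 1.\<close>
definition Tgrp :: "complex tgroup" where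
  "Tgrp = \<lparr>carrier = sphere 0 1, mult = (*), one = 1, gtop = top_of_set (sphere 0 1)\<rparr>"

definition characters :: "('a, 'b) tgroup_scheme \<Rightarrow> ('a \<Rightarrow> complex) set" where
  "characters G = {c. c \<in> hom G Tgrp \<and> continuous_map (gtop G) (gtop Tgrp) c \<and>
                        c \<in> extensional (carrier G)}"

definition compact_open :: "('a, 'b) tgroup_scheme \<Rightarrow> ('a \<Rightarrow> complex) topology" where
  "compact_open G = subtopology
     (topology_generated_by {{f. f ` K \<subseteq> U} | K U. compactin (gtop G) K \<and> openin (gtop Tgrp) U})
     (characters G)"

definition dual :: "('a, 'b) tgroup_scheme \<Rightarrow> ('a \<Rightarrow> complex) tgroup" where
  "dual G = \<lparr>carrier = characters G,
             mult = (\<lambda>c d. \<lambda>x\<in>carrier G. c x * d x),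
             one = (\<lambda>x\<in>carrier G. 1),
             gtop = compact_open G\<rparr>"

definition tprod :: "('a, 'c) tgroup_scheme \<Rightarrow> ('b, 'd) tgroup_scheme \<Rightarrow> ('a \<times> 'b) tgroup" where
  "tprod A B = \<lparr>carrier = carrier A \<times> carrier B,
                mult = (\<lambda>(a, b) (c, d). (a \<otimes>\<^bsub>A\<^esub> c, b \<otimes>\<^bsub>B\<^esub> d)),
                one = (\<one>\<^bsub>A\<^esub>, \<one>\<^bsub>B\<^esub>),
                gtop = prod_topology (gtop A) (gtop B)\<rparr>"

definition top_iso :: "('a, 'c) tgroup_scheme \<Rightarrow> ('b, 'd) tgroup_scheme \<Rightarrow> ('a \<Rightarrow> 'b) set" where
  "top_iso G H = {h. h \<in> iso G H \<and> homeomorphic_map (gtop G) (gtop H) h}"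

text \<open>Symplectic self-duality: nabla(x)(x) = 0 in R/Z, i.e. = 1 on the circle.\<close>
definition symplectic_self_duality :: "('a, 'b) tgroup_scheme \<Rightarrow> ('a \<Rightarrow> 'a \<Rightarrow> complex) \<Rightarrow> bool" where
  "symplectic_self_duality L N \<longleftrightarrow> N \<in> top_iso L (dual L) \<and> (\<forall>x\<in>carrier L. N x x = 1)"

text \<open>Standard symplectic self-duality of A x A^: nabla0(x,chi)(y,lambda) = chi(y) - lambda(x),
  written multiplicatively on the circle.\<close>
definition std_nabla :: "('a, 'c) tgroup_scheme \<Rightarrow> 'a \<times> ('a \<Rightarrow> complex) \<Rightarrow> 'a \<times> ('a \<Rightarrow> complex) \<Rightarrow> complex" where
  "std_nabla A = (\<lambda>(x, c) (y, l). c y * inverse (l x))"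

text \<open>(L, nabla) is standard. The LCA group A is taken with carrier in the same type as L;
  this loses no generality since any such A injects into L (via A x A^ \<cong> L).\<close>
definition standard :: "('a, 'b) tgroup_scheme \<Rightarrow> ('a \<Rightarrow> 'a \<Rightarrow> complex) \<Rightarrow> bool" where
  "standard L N \<longleftrightarrow> (\<exists>A :: 'a tgroup. LCA A \<and> (\<exists>\<phi>. \<phi> \<in> top_iso (tprod A (dual A)) L \<and>
      (\<forall>u\<in>carrier (tprod A (dual A)). \<forall>v\<in>carrier (tprod A (dual A)).
          N (\<phi> u) (\<phi> v) = std_nabla A u v)))"

end

theory Submission
  imports Defs "HOL-Algebra.Coset"
begin

text \<open>
  Write \<open>S\<^sup>\<bottom>\<close> for the annihilator of \<open>S\<close> under the pairing. Characters of a group of exponent \<open>p\<close>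
  take values in the finite group of \<open>p\<close>-th roots of unity, so for compact \<open>C\<close> the subgroup \<open>C\<^sup>\<bottom>\<close>
  is open, and by self-duality these subgroups form a neighbourhood base of the identity. If \<open>V\<close>
  is a compact neighbourhood of the identity and \<open>C\<^sup>\<bottom> \<subseteq> V\<close>, then \<open>C\<^sup>\<bottom> \<inter> V\<^sup>\<bottom>\<close> is an open isotropic
  subgroup. A maximal isotropic subgroup \<open>M\<close> above it satisfies \<open>M = M\<^sup>\<bottom>\<close>, and because every character
  trivial on \<open>M\<close> is continuous, hence represented by an element of \<open>M\<close>, a maximal isotropic
  subgroup \<open>D\<close> with \<open>M \<inter> D\<close> trivial is a complement of \<open>M\<close>. Now \<open>D\<close> is discrete and \<open>M\<close> is
  identified with the dual of \<open>D\<close> by restricting characters: the inverse extends a character of \<open>D\<close>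
  trivially to \<open>M\<close>.
\<close>

subsection \<open>Maximal subgroups and complements\<close>

text \<open>Zorn's lemma applies because a condition on pairs survives unions of chains: two
  elements of the union already lie in one member. Isotropy, trivial intersection with a fixed
  subgroup, and both at once all have this form.\<close>

lemma (in group) maximal_subgroup_pairwise:
  assumes K: "subgroup K G" "\<And>a b. a \<in> K \<Longrightarrow> b \<in> K \<Longrightarrow> Q a b"
  obtains M where "subgroup M G" "K \<subseteq> M" "\<And>a b. a \<in> M \<Longrightarrow> b \<in> M \<Longrightarrow> Q a b"
    "\<And>H. subgroup H G \<Longrightarrow> M \<subseteq> H \<Longrightarrow> \<forall>a\<in>H. \<forall>b\<in>H. Q a b \<Longrightarrow> H = M"
proof -
  define \<A> where "\<A> = {H. subgroup H G \<and> K \<subseteq> H \<and> (\<forall>a\<in>H. \<forall>b\<in>H. Q a b)}"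
  have "\<exists>M\<in>\<A>. \<forall>X\<in>\<A>. M \<subseteq> X \<longrightarrow> X = M"
  proof (rule subset_Zorn_nonempty)
    show "\<A> \<noteq> {}"
      using K by (auto simp: \<A>_def)
    fix \<C> assume ne: "\<C> \<noteq> {}" and ch: "subset.chain \<A> \<C>"
    have sub: "\<C> \<subseteq> \<A>"
      using ch by (auto simp: subset.chain_def)
    have two: "\<exists>X\<in>\<C>. a \<in> X \<and> b \<in> X" if "a \<in> \<Union>\<C>" "b \<in> \<Union>\<C>" for a b
      using that ch unfolding subset_chain_def by blast
    have "subgroup (\<Union>\<C>) G"
    proof
      show "\<Union>\<C> \<subseteq> carrier G"
        using sub subgroup.subset unfolding \<A>_def by blast
      show "\<one> \<in> \<Union>\<C>"
        using ne sub by (fastforce simp: \<A>_def dest: subgroup.one_closed)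
      show "x \<otimes> y \<in> \<Union>\<C>" if "x \<in> \<Union>\<C>" "y \<in> \<Union>\<C>" for x y
        using two[OF that] sub by (auto simp: \<A>_def intro: subgroup.m_closed)
      show "inv x \<in> \<Union>\<C>" if "x \<in> \<Union>\<C>" for x
        using that sub by (auto simp: \<A>_def intro: subgroup.m_inv_closed)
    qed
    moreover have "\<forall>a\<in>\<Union>\<C>. \<forall>b\<in>\<Union>\<C>. Q a b"
    proof (intro ballI)
      fix a b assume "a \<in> \<Union>\<C>" "b \<in> \<Union>\<C>"
      from two[OF this] show "Q a b" using sub by (auto simp: \<A>_def)
    qed
    moreover have "K \<subseteq> \<Union>\<C>"
      using ne sub unfolding \<A>_def by blast
    ultimately show "\<Union>\<C> \<in> \<A>"
      by (auto simp: \<A>_def)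
  qed
  then obtain M where M: "M \<in> \<A>" "\<And>X. X \<in> \<A> \<Longrightarrow> M \<subseteq> X \<Longrightarrow> X = M" by blast
  show ?thesis
  proof (rule that)
    show "subgroup M G" "K \<subseteq> M" "\<And>a b. a \<in> M \<Longrightarrow> b \<in> M \<Longrightarrow> Q a b"
      using M(1) by (auto simp: \<A>_def)
    show "H = M" if "subgroup H G" "M \<subseteq> H" "\<forall>a\<in>H. \<forall>b\<in>H. Q a b" for H
      using that M by (auto simp: \<A>_def intro!: M(2))
  qed
qed

text \<open>Natural exponents are enough to get the subgroup generated by \<open>H\<close> and
  \<open>x\<close> in a commutative group of exponent \<open>p\<close>, where inverses are
  powers.\<close>

definition (in monoid) adjoin :: "'a set \<Rightarrow> 'a \<Rightarrow> 'a set" where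
  "adjoin H x = {h \<otimes> x [^] (i::nat) | h i. h \<in> H}"

lemma (in group) subset_adjoin:
  assumes "subgroup H G" "x \<in> carrier G"
  shows "H \<subseteq> adjoin H x" "x \<in> adjoin H x"
proof -
  show "H \<subseteq> adjoin H x"
  proof
    fix h assume h: "h \<in> H"
    then have "h = h \<otimes> x [^] (0::nat)" using subgroup.mem_carrier[OF assms(1)] by auto
    then show "h \<in> adjoin H x" using h unfolding adjoin_def by blast
  qed
  have "x = \<one> \<otimes> x [^] (1::nat)" using assms by auto
  then show "x \<in> adjoin H x"
    using subgroup.one_closed[OF assms(1)] unfolding adjoin_def by blast
qed

lemma (in group) subset_set_mult:
  assumes "subgroup H G" "subgroup K G"
  shows "H \<subseteq> H <#> K" "K \<subseteq> H <#> K"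
proof -
  show "H \<subseteq> H <#> K"
  proof
    fix h assume h: "h \<in> H"
    then have "h \<otimes> \<one> \<in> H <#> K"
      using subgroup.one_closed[OF assms(2)] unfolding set_mult_def by blast
    then show "h \<in> H <#> K" using subgroup.mem_carrier[OF assms(1) h] by simp
  qed
  show "K \<subseteq> H <#> K"
  proof
    fix k assume k: "k \<in> K"
    then have "\<one> \<otimes> k \<in> H <#> K"
      using subgroup.one_closed[OF assms(1)] unfolding set_mult_def by blast
    then show "k \<in> H <#> K" using subgroup.mem_carrier[OF assms(2) k] by simp
  qed
qed

section \<open>Groups of exponent \<open>p\<close>, handled like vector spaces over the field with
  \<open>p\<close> elements\<close>

locale exponent_p_group = comm_group G for G (structure) +
  fixes p :: nat
  assumes prime_p: "prime p"
    and pow_p: "x \<in> carrier G \<Longrightarrow> x [^] p = \<one>"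
begin

lemma inv_eq_pow:
  assumes "x \<in> carrier G"
  shows "inv x = x [^] (p - 1)"
proof -
  have "x [^] (p - 1) \<otimes> x = x [^] Suc (p - 1)" by simp
  also have "\<dots> = \<one>" using pow_p[OF assms] prime_gt_0_nat[OF prime_p] by simp
  finally show ?thesis using assms by (metis inv_equality nat_pow_closed)
qed

lemma subgroup_adjoin:
  assumes H: "subgroup H G" and x: "x \<in> carrier G"
  shows "subgroup (adjoin H x) G"
proof -
  have car: "h \<in> carrier G" if "h \<in> H" for h using that H subgroup.mem_carrier by metis
  have sub: "adjoin H x \<subseteq> carrier G" using car x by (auto simp: adjoin_def)
  have mult: "a \<otimes> b \<in> adjoin H x" if "a \<in> adjoin H x" "b \<in> adjoin H x" for a b
  proof -
    obtain h i k j where ab: "a = h \<otimes> x [^] (i::nat)" "b = k \<otimes> x [^] (j::nat)" "h \<in> H" "k \<in> H"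
      using \<open>a \<in> _\<close> \<open>b \<in> _\<close> by (auto simp: adjoin_def)
    then have "a \<otimes> b = (h \<otimes> k) \<otimes> x [^] (i + j)"
      using car x by (simp add: nat_pow_mult[symmetric] m_ac)
    moreover have "h \<otimes> k \<in> H" using ab H by (simp add: subgroup.m_closed)
    ultimately show ?thesis unfolding adjoin_def by blast
  qed
  have one: "\<one> \<in> adjoin H x"
    using subset_adjoin(1)[OF H x] subgroup.one_closed[OF H] by blast
  have pow: "a [^] (n::nat) \<in> adjoin H x" if "a \<in> adjoin H x" for a n
    by (induction n) (use that one mult in auto)
  show ?thesis
    by (rule subgroupI) (use sub mult one pow inv_eq_pow in auto)
qed

text \<open>An exponent prime to \<open>p\<close> is invertible modulo \<open>p\<close> by Bezout,
  so \<open>x\<close> is itself a power of \<open>x [^] i\<close>.\<close>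

lemma mem_of_pow_mem:
  assumes H: "subgroup H G" and x: "x \<in> carrier G" and i: "x [^] (i::nat) \<in> H" "\<not> p dvd i"
  shows "x \<in> H"
proof -
  have "coprime i p"
    using i(2) prime_p by (metis coprime_commute prime_imp_coprime)
  then obtain u v where uv: "i * u = v * p + 1"
    using coprime_bezout_strong[of i p] prime_p prime_gt_1_nat
    by (metis mult.commute nat_neq_iff)
  have "(x [^] i) [^] u \<in> H" using i(1) H
    by (induction u) (auto intro: subgroup.m_closed subgroup.one_closed)
  moreover have "(x [^] i) [^] u = x"
    using x by (simp add: nat_pow_pow uv nat_pow_mult[symmetric] pow_p mult.commute[of v])
      (simp add: nat_pow_pow[symmetric] pow_p)
  ultimately show ?thesis by simp
qed

lemma pow_eq_one: "x \<in> carrier G \<Longrightarrow> p dvd i \<Longrightarrow> x [^] (i::nat) = \<one>"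
  by (metis dvdE nat_pow_one nat_pow_pow pow_p)

text \<open>If \<open>c \<otimes> x [^] i\<close> lies in \<open>D\<close>, then
  \<open>x [^] i\<close> lies in \<open>C <#> D\<close>. Since \<open>x\<close> does not,
  \<open>p\<close> divides \<open>i\<close>, the power disappears, and the element is
  \<open>c\<close>, which lies in \<open>C \<inter> D\<close>.\<close>

lemma adjoin_Int_trivial:
  assumes C: "subgroup C G" and D: "subgroup D G" and CD: "C \<inter> D = {\<one>}"
    and x: "x \<in> carrier G" "x \<notin> C <#> D"
  shows "adjoin C x \<inter> D = {\<one>}"
proof -
  have "a = \<one>" if a: "a \<in> adjoin C x" "a \<in> D" for a
  proof -
    obtain c i where c: "c \<in> C" "a = c \<otimes> x [^] (i::nat)"
      using a(1) unfolding adjoin_def by blast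
    have car: "c \<in> carrier G" "a \<in> carrier G"
      using c that C D subgroup.mem_carrier by metis+
    have "x [^] i = inv c \<otimes> a" using car x c inv_solve_left' by (metis nat_pow_closed)
    then have "x [^] i \<in> C <#> D"
      using c that C by (auto simp: set_mult_def subgroup.m_inv_closed)
    then have "p dvd i" using mem_of_pow_mem[OF mult_subgroups[OF C D]] x by blast
    then have "a = c" using c car x pow_eq_one by simp
    then show ?thesis using c that CD by auto
  qed
  moreover have "\<one> \<in> adjoin C x \<inter> D"
    using subgroup_adjoin[OF C x(1)] D by (simp add: subgroup.one_closed)
  ultimately show ?thesis by blast
qed

lemma complement_containing:
  assumes K: "subgroup K G" and D: "subgroup D G" and KD: "K \<inter> D = {\<one>}"
  obtains C where "subgroup C G" "K \<subseteq> C" "C \<inter> D = {\<one>}" "C <#> D = carrier G"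
proof -
  \<comment> \<open>Meeting \<open>D\<close> trivially is a condition on single elements; the second
    argument \<open>b\<close> is a dummy that fits it to the pairwise form.\<close>
  obtain C where C: "subgroup C G" "K \<subseteq> C" "\<And>a b. a \<in> C \<Longrightarrow> b \<in> C \<Longrightarrow> (a \<in> D \<longrightarrow> a = \<one>)"
    and max: "\<And>H. subgroup H G \<Longrightarrow> C \<subseteq> H \<Longrightarrow> \<forall>a\<in>H. \<forall>b\<in>H. a \<in> D \<longrightarrow> a = \<one> \<Longrightarrow> H = C"
    using maximal_subgroup_pairwise[OF K, of "\<lambda>a b. a \<in> D \<longrightarrow> a = \<one>"] KD by blast
  have CD: "C \<inter> D = {\<one>}"
    using C D by (auto simp: subgroup.one_closed)
  have "x \<in> C <#> D" if x: "x \<in> carrier G" for x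
  proof (rule ccontr)
    assume n: "x \<notin> C <#> D"
    have "adjoin C x = C"
      using max[OF subgroup_adjoin[OF C(1) x] subset_adjoin(1)[OF C(1) x]]
        adjoin_Int_trivial[OF C(1) D CD x n] by blast
    then have "x \<in> C" using subset_adjoin(2)[OF C(1) x] by simp
    then show False using n subset_set_mult(1)[OF C(1) D] by blast
  qed
  then have "C <#> D = carrier G"
    using subgroup.subset[OF mult_subgroups[OF C(1) D]] by blast
  then show ?thesis using that C CD by blast
qed

end

text \<open>The \<open>D\<close>-components may be chosen arbitrarily at first: the decomposition is
  unique because \<open>C\<close> and \<open>D\<close> meet trivially, and uniqueness makes the
  choice a homomorphism.\<close>

lemma (in comm_group) internal_projection:
  assumes C: "subgroup C G" and D: "subgroup D G" and CD: "C \<inter> D = {\<one>}" "C <#> D = carrier G"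
  obtains \<pi> where "\<pi> \<in> hom G G" "\<And>x. x \<in> carrier G \<Longrightarrow> \<pi> x \<in> D"
    "\<And>x. x \<in> carrier G \<Longrightarrow> x \<otimes> inv (\<pi> x) \<in> C"
    "\<And>c d. c \<in> C \<Longrightarrow> d \<in> D \<Longrightarrow> \<pi> (c \<otimes> d) = d"
proof -
  have car: "\<And>c. c \<in> C \<Longrightarrow> c \<in> carrier G" "\<And>d. d \<in> D \<Longrightarrow> d \<in> carrier G"
    using C D subgroup.mem_carrier by metis+
  have uniq: "d = d'" if "c \<in> C" "c' \<in> C" "d \<in> D" "d' \<in> D" "c \<otimes> d = c' \<otimes> d'" for c d c' d'
  proof -
    have "inv c' \<otimes> c = d' \<otimes> inv d"
      using that car by (metis inv_closed inv_solve_left inv_solve_right m_assoc m_closed)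
    moreover have "inv c' \<otimes> c \<in> C" "d' \<otimes> inv d \<in> D"
      using that C D by (simp_all add: subgroup.m_closed subgroup.m_inv_closed)
    ultimately have "d' \<otimes> inv d = \<one>" using CD by auto
    then show ?thesis using that car by (metis inv_closed inv_equality inv_inv)
  qed
  have "\<forall>x\<in>carrier G. \<exists>d. d \<in> D \<and> (\<exists>c\<in>C. x = c \<otimes> d)"
    using CD(2) unfolding set_mult_def by blast
  then obtain \<pi> where \<pi>: "\<And>x. x \<in> carrier G \<Longrightarrow> \<pi> x \<in> D \<and> (\<exists>c\<in>C. x = c \<otimes> \<pi> x)" by metis
  have eq: "\<pi> (c \<otimes> d) = d" if "c \<in> C" "d \<in> D" for c d
    using \<pi>[of "c \<otimes> d"] uniq that car by (metis m_closed)
  show ?thesis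
  proof (rule that)
    show "\<pi> x \<in> D" if "x \<in> carrier G" for x using \<pi> that by blast
    show "x \<otimes> inv (\<pi> x) \<in> C" if "x \<in> carrier G" for x
    proof -
      obtain c where c: "c \<in> C" "x = c \<otimes> \<pi> x" using \<pi> \<open>x \<in> carrier G\<close> by blast
      have "x \<otimes> inv (\<pi> x) = c \<otimes> \<pi> x \<otimes> inv (\<pi> x)" using c(2) by simp
      also have "\<dots> = c" using c(1) \<pi>[OF that] car by (simp add: m_assoc)
      finally show ?thesis using c(1) by simp
    qed
    show "\<pi> (c \<otimes> d) = d" if "c \<in> C" "d \<in> D" for c d by (rule eq) fact+
    show "\<pi> \<in> hom G G"
    proof (rule homI)
      show "\<pi> x \<in> carrier G" if "x \<in> carrier G" for x using \<pi> that car by blast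
      fix x y assume xy: "x \<in> carrier G" "y \<in> carrier G"
      obtain c c' where c: "c \<in> C" "x = c \<otimes> \<pi> x" "c' \<in> C" "y = c' \<otimes> \<pi> y"
        using \<pi> xy by metis
      have d: "\<pi> x \<in> D" "\<pi> y \<in> D" using \<pi> xy by auto
      have "x \<otimes> y = (c \<otimes> \<pi> x) \<otimes> (c' \<otimes> \<pi> y)" using c by simp
      also have "\<dots> = (c \<otimes> c') \<otimes> (\<pi> x \<otimes> \<pi> y)" using c(1,3) d car by (simp add: m_ac)
      finally show "\<pi> (x \<otimes> y) = \<pi> x \<otimes> \<pi> y"
        using eq[of "c \<otimes> c'" "\<pi> x \<otimes> \<pi> y"] c d C D by (simp add: subgroup.m_closed)
    qed
  qed
qed

subsection \<open>Characters and the compact-open topology\<close>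

lemma topspace_compact_open [simp]: "topspace (compact_open G) = characters G"
proof -
  \<comment> \<open>Taking \<open>K\<close> empty makes the set of all functions subbasic, so the
    generated topology lives on all functions before it is cut down to characters.\<close>
  have "{f. f ` {} \<subseteq> U} \<in> {{f. f ` K \<subseteq> U} |K U. compactin (gtop G) K \<and> openin (gtop Tgrp) U}"
    if "openin (gtop Tgrp) U" for U
    using that compactin_empty by blast
  then have "UNIV \<in> {{f. f ` K \<subseteq> U} |K U. compactin (gtop G) K \<and> openin (gtop Tgrp) U}"
    using openin_empty[of "gtop Tgrp"] by fastforce
  then show ?thesis
    unfolding compact_open_def by (auto simp: topology_generated_by_topspace)
qed

lemma openin_compact_open_basic:
  assumes "compactin (gtop G) K" "openin (gtop Tgrp) U"
  shows "openin (compact_open G) {f \<in> characters G. f ` K \<subseteq> U}"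
proof -
  have "openin (topology_generated_by {{f. f ` K \<subseteq> U} | K U. compactin (gtop G) K \<and> openin (gtop Tgrp) U})
      {f. f ` K \<subseteq> U}"
    by (rule topology_generated_by_Basis) (use assms in blast)
  then show ?thesis
    unfolding compact_open_def openin_subtopology by blast
qed

lemma continuous_map_compact_openI:
  assumes "\<And>x. x \<in> topspace X \<Longrightarrow> f x \<in> characters G"
    and "\<And>K U. compactin (gtop G) K \<Longrightarrow> openin (gtop Tgrp) U \<Longrightarrow> openin X {x \<in> topspace X. f x ` K \<subseteq> U}"
  shows "continuous_map X (compact_open G) f"
  unfolding compact_open_def
proof (rule continuous_map_into_subtopology)
  show "f \<in> topspace X \<rightarrow> characters G" using assms(1) by blast
  show "continuous_map X (topology_generated_by {{f. f ` K \<subseteq> U} | K U. compactin (gtop G) K \<and> openin (gtop Tgrp) U}) f"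
  proof (rule continuous_on_generated_topo)
    fix V assume "V \<in> {{f. f ` K \<subseteq> U} | K U. compactin (gtop G) K \<and> openin (gtop Tgrp) U}"
    then obtain K U where V: "V = {f. f ` K \<subseteq> U}" and "compactin (gtop G) K" "openin (gtop Tgrp) U"
      by blast
    moreover have "f -` V \<inter> topspace X = {x \<in> topspace X. f x ` K \<subseteq> U}" using V by auto
    ultimately show "openin X (f -` V \<inter> topspace X)" using assms(2) by simp
  next
    have "UNIV \<in> {{f. f ` K \<subseteq> U} | K U. compactin (gtop G) K \<and> openin (gtop Tgrp) U}"
      using compactin_empty[of "gtop G"] openin_topspace[of "gtop Tgrp"] by fastforce
    then show "f ` topspace X \<subseteq> \<Union> {{f. f ` K \<subseteq> U} | K U. compactin (gtop G) K \<and> openin (gtop Tgrp) U}"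
      by blast
  qed
qed

text \<open>Induction over the generated topology: an intersection is served by the union of the two
  compact sets, a union by the compact set of one member. For general \<open>G\<close> the
  characters trivial on \<open>C\<close> need not form a neighbourhood; only their inclusion in
  \<open>W\<close> is claimed.\<close>

lemma compact_open_nhd_of_trivial:
  assumes "openin (compact_open G) W" and "(\<lambda>x\<in>carrier G. 1) \<in> W"
    and "topspace (gtop G) = carrier G"
  obtains C where "compactin (gtop G) C"
    "\<And>\<psi>. \<psi> \<in> characters G \<Longrightarrow> (\<And>x. x \<in> C \<Longrightarrow> \<psi> x = 1) \<Longrightarrow> \<psi> \<in> W"
proof -
  let ?B = "{{f. f ` K \<subseteq> U} | K U. compactin (gtop G) K \<and> openin (gtop Tgrp) U}"
  let ?t = "\<lambda>x\<in>carrier G. 1 :: complex"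
  obtain V where V: "openin (topology_generated_by ?B) V" "W = V \<inter> characters G"
    using assms(1) unfolding compact_open_def openin_subtopology by blast
  have "generate_topology_on ?B V"
    using V(1) by (rule openin_topology_generated_by)
  then have "?t \<in> V \<Longrightarrow> \<exists>C. compactin (gtop G) C \<and> (\<forall>\<psi>. (\<forall>x\<in>C. \<psi> x = 1) \<longrightarrow> \<psi> \<in> V)"
  proof (induction rule: generate_topology_on.induct)
    case Empty
    then show ?case by simp
  next
    case (Int a b)
    then obtain C D where "compactin (gtop G) C" "\<forall>\<psi>. (\<forall>x\<in>C. \<psi> x = 1) \<longrightarrow> \<psi> \<in> a"
      "compactin (gtop G) D" "\<forall>\<psi>. (\<forall>x\<in>D. \<psi> x = 1) \<longrightarrow> \<psi> \<in> b" by auto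
    then show ?case by (intro exI[of _ "C \<union> D"]) (auto intro: compactin_Un)
  next
    case (UN K)
    then show ?case by (meson UnionE UnionI)
  next
    case (Basis s)
    then obtain K U where s: "s = {f. f ` K \<subseteq> U}" "compactin (gtop G) K" by blast
    \<comment> \<open>Inside the carrier the restricted constant function really has the value 1, so
      its membership in \<open>s\<close> gives \<open>1 \<in> U\<close> as soon as \<open>K\<close>
      has a point.\<close>
    then have "K \<subseteq> carrier G" using compactin_subset_topspace assms(3) by metis
    then have "\<psi> \<in> s" if "\<forall>x\<in>K. \<psi> x = 1" for \<psi>
      using Basis(2) that unfolding s by (auto simp: image_subset_iff subset_iff)
    then show ?case using s by blast
  qed
  moreover have "?t \<in> V" using assms(2) V by blast
  ultimately show ?thesis using that V by blast
qed

section \<open>Maps constant on the cosets of an open subgroup\<close>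

lemma continuous_map_mult:
  fixes G (structure)
  assumes "LCA G" "continuous_map X (gtop G) f" "continuous_map X (gtop G) g"
  shows "continuous_map X (gtop G) (\<lambda>x. f x \<otimes> g x)"
  using continuous_map_compose[OF continuous_map_pairedI[OF assms(2,3)]] assms(1)
  by (fastforce simp: LCA_def o_def)

lemma openin_translate:
  fixes G (structure)
  assumes "LCA G" "openin (gtop G) K" "a \<in> carrier G"
  shows "openin (gtop G) {x \<in> carrier G. inv\<^bsub>G\<^esub> a \<otimes>\<^bsub>G\<^esub> x \<in> K}"
proof -
  interpret comm_group G using assms(1) by (simp add: LCA_def)
  have top: "topspace (gtop G) = carrier G" using assms(1) by (simp add: LCA_def)
  have "continuous_map (gtop G) (gtop G) (\<lambda>x. inv a \<otimes> x)"
    using assms(3) by (intro continuous_map_mult[OF assms(1)]) (auto simp: top)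
  from openin_continuous_map_preimage[OF this assms(2)] show ?thesis
    by (simp add: top)
qed

text \<open>The cosets of \<open>M\<close> are open, so \<open>f\<close> is locally constant and
  hence continuous for every topology on the target.\<close>

lemma continuous_map_if_open_periods:
  fixes G (structure)
  assumes G: "LCA G" and M: "openin (gtop G) M" "subgroup M G"
    and f: "\<And>x. x \<in> carrier G \<Longrightarrow> f x \<in> topspace Y"
      "\<And>x m. x \<in> carrier G \<Longrightarrow> m \<in> M \<Longrightarrow> f (x \<otimes>\<^bsub>G\<^esub> m) = f x"
  shows "continuous_map (gtop G) Y f"
proof -
  interpret comm_group G using G by (simp add: LCA_def)
  have top: "topspace (gtop G) = carrier G" using G by (simp add: LCA_def)
  have "openin (gtop G) {x \<in> carrier G. f x \<in> U}" if "openin Y U" for U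
  proof (subst openin_subopen, intro ballI)
    fix x assume "x \<in> {x \<in> carrier G. f x \<in> U}"
    then have x: "x \<in> carrier G" "f x \<in> U" by auto
    let ?T = "{y \<in> carrier G. inv x \<otimes> y \<in> M}"
    have "openin (gtop G) ?T" using openin_translate[OF G M(1) x(1)] .
    moreover have "x \<in> ?T" using x M(2) by (simp add: subgroup.one_closed)
    moreover have "?T \<subseteq> {x \<in> carrier G. f x \<in> U}"
    proof
      fix y assume "y \<in> ?T"
      then have y: "y \<in> carrier G" "inv x \<otimes> y \<in> M" by auto
      have "y = x \<otimes> (inv x \<otimes> y)" using y(1) x by (simp add: m_assoc[symmetric])
      then have "f y = f x" using f(2)[OF x(1) y(2)] by simp
      then show "y \<in> {x \<in> carrier G. f x \<in> U}" using x(2) y(1) by simp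
    qed
    ultimately show "\<exists>T. openin (gtop G) T \<and> x \<in> T \<and> T \<subseteq> {x \<in> carrier G. f x \<in> U}"
      by blast
  qed
  then show ?thesis using f(1) by (auto simp: continuous_map_def top)
qed

text \<open>Membership in \<open>M\<close> is invariant under translation by \<open>K\<close>, hence
  continuous as a map to a discrete two-point space; \<open>M\<close> is the preimage of
  \<open>True\<close>.\<close>

lemma openin_subgroup_superset:
  fixes G (structure)
  assumes G: "LCA G" and K: "openin (gtop G) K" "subgroup K G" and M: "subgroup M G" "K \<subseteq> M"
  shows "openin (gtop G) M"
proof -
  interpret comm_group G using G by (simp add: LCA_def)
  have top: "topspace (gtop G) = carrier G" using G by (simp add: LCA_def)
  have "x \<otimes> m \<in> M \<longleftrightarrow> x \<in> M" if "x \<in> carrier G" "m \<in> K" for x m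
  proof
    have m: "m \<in> M" "m \<in> carrier G" using that M subgroup.mem_carrier by fastforce+
    show "x \<otimes> m \<in> M" if "x \<in> M" using that m M(1) by (simp add: subgroup.m_closed)
    assume "x \<otimes> m \<in> M"
    then have "x \<otimes> m \<otimes> inv m \<in> M" using m M(1) by (simp add: subgroup.m_closed subgroup.m_inv_closed)
    then show "x \<in> M" using m that(1) by (simp add: m_assoc)
  qed
  then have "continuous_map (gtop G) (discrete_topology UNIV) (\<lambda>x. x \<in> M)"
    by (intro continuous_map_if_open_periods[OF G K]) auto
  from openin_continuous_map_preimage[OF this, of "{True}"]
  have "openin (gtop G) {x \<in> carrier G. x \<in> M}" by (simp add: top)
  moreover have "{x \<in> carrier G. x \<in> M} = M" using M(1) subgroup.subset by blast
  ultimately show ?thesis by simp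
qed

lemma charactersD:
  assumes "\<psi> \<in> characters G"
  shows "\<And>x. x \<in> carrier G \<Longrightarrow> cmod (\<psi> x) = 1"
    and "\<And>x y. x \<in> carrier G \<Longrightarrow> y \<in> carrier G \<Longrightarrow> \<psi> (x \<otimes>\<^bsub>G\<^esub> y) = \<psi> x * \<psi> y"
    and "\<psi> \<in> extensional (carrier G)"
    and "continuous_map (gtop G) (top_of_set (sphere 0 1)) \<psi>"
  using assms by (auto simp: characters_def Tgrp_def hom_def dist_norm)

lemma charactersI:
  assumes "\<And>x. x \<in> carrier G \<Longrightarrow> cmod (\<psi> x) = 1"
    and "\<And>x y. x \<in> carrier G \<Longrightarrow> y \<in> carrier G \<Longrightarrow> \<psi> (x \<otimes>\<^bsub>G\<^esub> y) = \<psi> x * \<psi> y"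
    and "\<psi> \<in> extensional (carrier G)"
    and "continuous_map (gtop G) (top_of_set (sphere 0 1)) \<psi>"
  shows "\<psi> \<in> characters G"
  using assms by (auto simp: characters_def Tgrp_def hom_def dist_norm)

text \<open>Continuity comes for free here, so characters can be built by pure algebra as long as
  they are trivial on an open subgroup.\<close>

lemma character_if_trivial_on_open:
  fixes G (structure)
  assumes G: "LCA G" and M: "openin (gtop G) M" "subgroup M G"
    and \<psi>: "\<And>x. x \<in> carrier G \<Longrightarrow> cmod (\<psi> x) = 1"
      "\<And>x y. x \<in> carrier G \<Longrightarrow> y \<in> carrier G \<Longrightarrow> \<psi> (x \<otimes>\<^bsub>G\<^esub> y) = \<psi> x * \<psi> y"
      "\<And>m. m \<in> M \<Longrightarrow> \<psi> m = 1"
  shows "restrict \<psi> (carrier G) \<in> characters G"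
proof -
  interpret comm_group G using G by (simp add: LCA_def)
  have car: "m \<in> carrier G" if "m \<in> M" for m using that M(2) subgroup.mem_carrier by metis
  show ?thesis
    by (intro charactersI continuous_map_if_open_periods[OF G M]) (auto simp: \<psi> car)
qed

subsection \<open>Isotropic subgroups of a symplectically self-dual group\<close>

locale symplectic_p_group = exponent_p_group L p for L :: "'a tgroup" (structure) and p +
  fixes N :: "'a \<Rightarrow> 'a \<Rightarrow> complex"
  assumes LCA_L: "LCA L" and symp: "symplectic_self_duality L N"
begin

lemma topspace_L [simp]: "topspace (gtop L) = carrier L"
  using LCA_L by (simp add: LCA_def)

lemma N_iso: "N \<in> iso L (dual L)" and N_homeo: "homeomorphic_map (gtop L) (compact_open L) N"
  using symp by (simp_all add: symplectic_self_duality_def top_iso_def dual_def)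

lemma N_bij: "bij_betw N (carrier L) (characters L)"
  using N_iso by (simp add: iso_def dual_def)

lemma N_char: "x \<in> carrier L \<Longrightarrow> N x \<in> characters L"
  using N_bij by (auto simp: bij_betw_def)

lemma N_eqI: "x \<in> carrier L \<Longrightarrow> y \<in> carrier L \<Longrightarrow> (\<And>z. z \<in> carrier L \<Longrightarrow> N x z = N y z) \<Longrightarrow> x = y"
  by (rule inj_onD[OF bij_betw_imp_inj_on[OF N_bij]])
    (auto intro: extensionalityI[OF charactersD(3)[OF N_char] charactersD(3)[OF N_char]])

lemma norm_N [simp]: "x \<in> carrier L \<Longrightarrow> y \<in> carrier L \<Longrightarrow> cmod (N x y) = 1"
  by (rule charactersD(1)[OF N_char])

lemma N_neq_0 [simp]: "x \<in> carrier L \<Longrightarrow> y \<in> carrier L \<Longrightarrow> N x y \<noteq> 0"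
  by (metis norm_N norm_zero zero_neq_one)

lemma N_mult_right:
  "x \<in> carrier L \<Longrightarrow> y \<in> carrier L \<Longrightarrow> z \<in> carrier L \<Longrightarrow> N x (y \<otimes> z) = N x y * N x z"
  by (rule charactersD(2)[OF N_char])

lemma N_mult_left:
  assumes "x \<in> carrier L" "y \<in> carrier L" "z \<in> carrier L"
  shows "N (x \<otimes> y) z = N x z * N y z"
proof -
  have "N (x \<otimes> y) = (\<lambda>z\<in>carrier L. N x z * N y z)"
    using N_iso assms by (simp add: iso_def hom_def dual_def)
  then show ?thesis using assms by simp
qed

lemma N_self: "x \<in> carrier L \<Longrightarrow> N x x = 1"
  using symp by (simp add: symplectic_self_duality_def)

text \<open>Polarisation: expand the pairing of \<open>x \<otimes> y\<close> with itself, where the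
  diagonal factors are 1. Left and right annihilators therefore agree.\<close>

lemma N_swap:
  assumes "x \<in> carrier L" "y \<in> carrier L"
  shows "N y x = inverse (N x y)"
proof -
  have "N (x \<otimes> y) (x \<otimes> y) = N x (x \<otimes> y) * N y (x \<otimes> y)"
    using assms by (intro N_mult_left) auto
  also have "\<dots> = N x y * N y x"
    using assms by (simp add: N_mult_right N_self)
  finally have "N (x \<otimes> y) (x \<otimes> y) = N x y * N y x" .
  then have "N x y * N y x = 1" using assms by (simp add: N_self)
  then show ?thesis by (simp add: inverse_unique)
qed

lemma N_one_right [simp]:
  assumes "x \<in> carrier L" shows "N x \<one> = 1"
proof -
  have "N x \<one> * N x \<one> = N x \<one>" using N_mult_right[of x \<one> \<one>] assms by simp
  then show ?thesis using assms by simp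
qed

lemma N_one_left [simp]: "x \<in> carrier L \<Longrightarrow> N \<one> x = 1"
  by (simp add: N_swap[of x \<one>])

lemma N_pow_right: "x \<in> carrier L \<Longrightarrow> y \<in> carrier L \<Longrightarrow> N x (y [^] (i::nat)) = N x y ^ i"
  by (induction i) (simp_all add: N_mult_right)

lemma N_pow_left: "x \<in> carrier L \<Longrightarrow> y \<in> carrier L \<Longrightarrow> N (x [^] (i::nat)) y = N x y ^ i"
  by (induction i) (simp_all add: N_mult_left)

lemma N_inv_left:
  assumes "x \<in> carrier L" "y \<in> carrier L"
  shows "N (inv x) y = inverse (N x y)"
  using N_mult_left[of x "inv x" y] assms by (simp add: inverse_unique)

lemma N_root: "x \<in> carrier L \<Longrightarrow> y \<in> carrier L \<Longrightarrow> N x y ^ p = 1"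
  by (metis N_one_right N_pow_right pow_p)

section \<open>Annihilators as small open subgroups\<close>

definition perp :: "'a set \<Rightarrow> 'a set" where
  "perp S = {x \<in> carrier L. \<forall>s\<in>S. N x s = 1}"

lemma subgroup_perp:
  assumes "S \<subseteq> carrier L"
  shows "subgroup (perp S) L"
  by (rule subgroupI)
    (use assms in \<open>auto simp: perp_def N_mult_left N_inv_left subset_iff intro!: exI[of _ \<one>]\<close>)

text \<open>The \<open>p\<close>-th roots of unity other than \<open>1\<close> stay away from \<open>1\<close>, so a character near the
  trivial one on a compact set is trivial on it.\<close>
lemma openin_perp:
  assumes C: "compactin (gtop L) C"
  shows "openin (gtop L) (perp C)"
proof -
  let ?R = "{z::complex. z ^ p = 1} - {1}"
  let ?U = "sphere 0 1 - ?R"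
  have "finite ?R" using finite_roots_unity[of p] prime_gt_0_nat[OF prime_p] by (simp add: Suc_leI)
  then have "closed ?R" by (rule finite_imp_closed)
  then have U: "openin (gtop Tgrp) ?U"
    by (auto simp: Tgrp_def openin_open Diff_eq open_Compl)
  have car: "C \<subseteq> carrier L" using compactin_subset_topspace[OF C] by simp
  have "openin (gtop L) {x \<in> carrier L. N x \<in> {f \<in> characters L. f ` C \<subseteq> ?U}}"
    using openin_continuous_map_preimage[OF homeomorphic_imp_continuous_map[OF N_homeo]
        openin_compact_open_basic[OF C U]] by simp
  moreover have "{x \<in> carrier L. N x \<in> {f \<in> characters L. f ` C \<subseteq> ?U}} = perp C"
    using car by (auto simp: perp_def N_char N_root image_subset_iff subset_iff)
  ultimately show ?thesis by simp
qed

lemma nhd_contains_perp: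
  assumes W: "openin (gtop L) W" "\<one> \<in> W"
  obtains C where "compactin (gtop L) C" "perp C \<subseteq> W"
proof -
  have sub: "W \<subseteq> carrier L" using openin_subset[OF W(1)] by simp
  have o: "openin (compact_open L) (N ` W)"
    using homeomorphic_imp_open_map[OF N_homeo] W(1) by (simp add: open_map_def)
  have "N \<one> = (\<lambda>x\<in>carrier L. 1)"
    using charactersD(3)[OF N_char[of \<one>]] by (intro extensionalityI[of _ "carrier L"]) auto
  then have "(\<lambda>x\<in>carrier L. 1) \<in> N ` W" using W(2) by (metis imageI)
  then obtain C where C: "compactin (gtop L) C"
    "\<And>\<psi>. \<psi> \<in> characters L \<Longrightarrow> (\<And>x. x \<in> C \<Longrightarrow> \<psi> x = 1) \<Longrightarrow> \<psi> \<in> N ` W"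
    using compact_open_nhd_of_trivial[OF o] topspace_L by metis
  have "x \<in> W" if "x \<in> perp C" for x
  proof -
    have x: "x \<in> carrier L" "N x \<in> N ` W" using that C(2) N_char by (auto simp: perp_def)
    then show ?thesis using N_bij sub by (auto simp: bij_betw_def inj_on_def subset_iff)
  qed
  then show ?thesis using that C(1) by blast
qed

lemma open_isotropic_subgroup:
  obtains K where "subgroup K L" "openin (gtop L) K" "\<And>a b. a \<in> K \<Longrightarrow> b \<in> K \<Longrightarrow> N a b = 1"
proof -
  have "locally_compact_space (gtop L)" using LCA_L by (simp add: LCA_def)
  then obtain W V where W: "openin (gtop L) W" "compactin (gtop L) V" "\<one> \<in> W" "W \<subseteq> V"
    unfolding locally_compact_space_def by (metis one_closed topspace_L)
  obtain C where C: "compactin (gtop L) C" "perp C \<subseteq> W" using nhd_contains_perp W by metis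
  have CV: "compactin (gtop L) (C \<union> V)" using C W by (simp add: compactin_Un)
  have eq: "perp (C \<union> V) = perp C \<inter> perp V" by (auto simp: perp_def)
  show ?thesis
  proof (rule that)
    show "subgroup (perp (C \<union> V)) L"
      using subgroup_perp compactin_subset_topspace[OF CV] by simp
    show "openin (gtop L) (perp (C \<union> V))" using openin_perp[OF CV] .
    fix a b assume "a \<in> perp (C \<union> V)" "b \<in> perp (C \<union> V)"
    \<comment> \<open>The two halves of the annihilator play different parts: \<open>b\<close> lies
      in \<open>perp C\<close> and so in \<open>V\<close>, while \<open>a\<close> annihilates
      \<open>V\<close>.\<close>
    then have "a \<in> perp V" "b \<in> V" using C W eq by auto
    then show "N a b = 1" by (simp add: perp_def)
  qed
qed

section \<open>Maximal isotropic subgroups and their complements\<close>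

lemma isotropic_adjoin:
  assumes H: "subgroup H L" "\<And>a b. a \<in> H \<Longrightarrow> b \<in> H \<Longrightarrow> N a b = 1"
    and x: "x \<in> carrier L" "\<And>a. a \<in> H \<Longrightarrow> N x a = 1"
    and ab: "a \<in> adjoin H x" "b \<in> adjoin H x"
  shows "N a b = 1"
proof -
  obtain h i k j where eq: "a = h \<otimes> x [^] (i::nat)" "b = k \<otimes> x [^] (j::nat)" "h \<in> H" "k \<in> H"
    using ab unfolding adjoin_def by blast
  have "h \<in> carrier L" "k \<in> carrier L" using eq H(1) subgroup.mem_carrier by metis+
  \<comment> \<open>Expanding gives powers of \<open>N h k\<close>, \<open>N h x\<close>,
    \<open>N x k\<close> and \<open>N x x\<close>. The last is 1 because the pairing is alternating,
    and \<open>N h x\<close> is 1 by \<open>N_swap\<close>.\<close>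
  then show ?thesis
    using eq x H(2) N_swap[of x h]
    by (simp add: N_mult_left N_mult_right N_pow_left N_pow_right N_self)
qed

text \<open>Adjoining an element of \<open>perp M\<close> keeps \<open>M\<close> isotropic, so
  maximality already puts that element in \<open>M\<close>. Starting from an open \<open>K\<close>
  makes \<open>M\<close> open.\<close>

lemma open_Lagrangian:
  obtains M where "subgroup M L" "openin (gtop L) M" "perp M = M"
proof -
  obtain K where K: "subgroup K L" "openin (gtop L) K" "\<And>a b. a \<in> K \<Longrightarrow> b \<in> K \<Longrightarrow> N a b = 1"
    using open_isotropic_subgroup by blast
  obtain M where M: "subgroup M L" "K \<subseteq> M" "\<And>a b. a \<in> M \<Longrightarrow> b \<in> M \<Longrightarrow> N a b = 1"
    and max: "\<And>H. subgroup H L \<Longrightarrow> M \<subseteq> H \<Longrightarrow> \<forall>a\<in>H. \<forall>b\<in>H. N a b = 1 \<Longrightarrow> H = M"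
    using maximal_subgroup_pairwise[OF K(1), of "\<lambda>a b. N a b = 1"] K(3) by blast
  have "x \<in> M" if "x \<in> perp M" for x
  proof -
    have x: "x \<in> carrier L" "\<And>a. a \<in> M \<Longrightarrow> N x a = 1" using that by (auto simp: perp_def)
    have "adjoin M x = M"
      by (rule max[OF subgroup_adjoin[OF M(1) x(1)] subset_adjoin(1)[OF M(1) x(1)]])
        (intro ballI isotropic_adjoin[OF M(1,3) x])
    then show ?thesis using subset_adjoin(2)[OF M(1) x(1)] by simp
  qed
  moreover have "M \<subseteq> perp M"
    using M(3) subgroup.mem_carrier[OF M(1)] by (auto simp: perp_def)
  ultimately show ?thesis
    using that[OF M(1) openin_subgroup_superset[OF LCA_L K(2,1) M(1,2)]] by blast
qed

text \<open>Surjectivity of \<open>N\<close> gives a representing element; triviality of the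
  character on \<open>M\<close> places it in \<open>perp M\<close>, which is
  \<open>M\<close>.\<close>

lemma Lagrangian_represents:
  assumes M: "perp M = M" and \<psi>: "\<psi> \<in> characters L" "\<And>m. m \<in> M \<Longrightarrow> \<psi> m = 1"
  obtains m where "m \<in> M" "N m = \<psi>"
proof -
  obtain m where m: "m \<in> carrier L" "N m = \<psi>"
    using N_bij \<psi>(1) by (metis bij_betw_def imageE)
  then have "m \<in> perp M" using \<psi>(2) by (auto simp: perp_def)
  then show ?thesis using m that M by simp
qed

text \<open>\<open>D\<close> is maximal for isotropy and trivial intersection with \<open>M\<close>
  together. An element outside \<open>M <#> D\<close> can be moved within its coset of
  \<open>M\<close> until it is orthogonal to \<open>D\<close>; adjoining it then contradicts
  maximality.\<close>

lemma Lagrangian_complement: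
  assumes M: "subgroup M L" "openin (gtop L) M" "perp M = M"
  obtains D where "subgroup D L" "\<And>a b. a \<in> D \<Longrightarrow> b \<in> D \<Longrightarrow> N a b = 1"
    "M \<inter> D = {\<one>}" "M <#> D = carrier L"
proof -
  let ?Q = "\<lambda>a b. N a b = 1 \<and> (a \<in> M \<longrightarrow> a = \<one>)"
  obtain D where D: "subgroup D L" "{\<one>} \<subseteq> D" "\<And>a b. a \<in> D \<Longrightarrow> b \<in> D \<Longrightarrow> ?Q a b"
    and max: "\<And>H. subgroup H L \<Longrightarrow> D \<subseteq> H \<Longrightarrow> \<forall>a\<in>H. \<forall>b\<in>H. ?Q a b \<Longrightarrow> H = D"
  proof (rule maximal_subgroup_pairwise[OF triv_subgroup, of ?Q])
    show "?Q a b" if "a \<in> {\<one>}" "b \<in> {\<one>}" for a b using that by simp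
  qed (rule that)
  have MD: "M \<inter> D = {\<one>}"
    using D M(1) by (auto simp: subgroup.one_closed)
  have Dcar: "d \<in> carrier L" if "d \<in> D" for d using that D(1) subgroup.mem_carrier by metis
  have Mcar: "m \<in> carrier L" if "m \<in> M" for m using that M(1) subgroup.mem_carrier by metis
  have "z \<in> M <#> D" if z: "z \<in> carrier L" for z
  proof (rule ccontr)
    assume n: "z \<notin> M <#> D"
    \<comment> \<open>It is not yet known that \<open>M\<close> and \<open>D\<close> span
      \<open>L\<close>. Projecting along a complement \<open>C\<close> of \<open>D\<close> that
      contains \<open>M\<close> still extends homomorphisms from \<open>D\<close> to
      \<open>L\<close> trivially on \<open>M\<close>.\<close>
    obtain C where C: "subgroup C L" "M \<subseteq> C" "C \<inter> D = {\<one>}" "C <#> D = carrier L"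
      using complement_containing[OF M(1) D(1) MD] by metis
    obtain \<pi> where \<pi>: "\<pi> \<in> hom L L" "\<And>x. x \<in> carrier L \<Longrightarrow> \<pi> x \<in> D"
      "\<And>c d. c \<in> C \<Longrightarrow> d \<in> D \<Longrightarrow> \<pi> (c \<otimes> d) = d"
      using internal_projection[OF C(1) D(1) C(3,4)] by metis
    have \<pi>D: "\<pi> d = d" if "d \<in> D" for d
      using \<pi>(3)[OF subgroup.one_closed[OF C(1)] that] Dcar[OF that] by simp
    have \<pi>M: "\<pi> m = \<one>" if "m \<in> M" for m
      using \<pi>(3)[of m \<one>] that C(2) subgroup.one_closed[OF D(1)] Mcar[OF that] by auto
    have \<pi>c: "\<pi> x \<in> carrier L" if "x \<in> carrier L" for x using Dcar \<pi>(2) that by blast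
    \<comment> \<open>Correct \<open>z\<close> by the element of \<open>M\<close> representing the character \<open>d \<mapsto> N d z\<close> of \<open>D\<close>.\<close>
    let ?\<psi> = "\<lambda>x\<in>carrier L. N (\<pi> x) z"
    have "?\<psi> \<in> characters L"
      by (rule character_if_trivial_on_open[OF LCA_L M(2,1)])
        (use z \<pi>c \<pi>M in \<open>auto simp: hom_mult[OF \<pi>(1)] N_mult_left\<close>)
    moreover have "?\<psi> m = 1" if "m \<in> M" for m using that \<pi>M z Mcar by simp
    ultimately obtain m where m: "m \<in> M" "N m = ?\<psi>"
      using Lagrangian_represents[OF M(3)] by blast
    let ?y = "z \<otimes> m"
    have y: "?y \<in> carrier L" using z m Mcar by simp
    \<comment> \<open>The factor \<open>N m d\<close> equals \<open>N d z\<close>, which cancels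
      \<open>N z d\<close> by antisymmetry.\<close>
    have yD: "N ?y d = 1" if "d \<in> D" for d
      using that m z Mcar Dcar \<pi>D N_swap[of z d] by (simp add: N_mult_left)
    have yn: "?y \<notin> M <#> D"
    proof
      assume "?y \<in> M <#> D"
      moreover have "inv m \<in> M <#> D"
        using subset_set_mult(1)[OF M(1) D(1)] subgroup.m_inv_closed[OF M(1) m(1)] by blast
      ultimately have "?y \<otimes> inv m \<in> M <#> D"
        using mult_subgroups[OF M(1) D(1)] by (simp add: subgroup.m_closed)
      then show False using n z m Mcar by (simp add: m_assoc)
    qed
    have comm: "M <#> D = D <#> M"
      using Mcar Dcar m_comm unfolding set_mult_def by blast
    have DM: "D \<inter> M = {\<one>}" using MD by blast
    have "adjoin D ?y = D"
    proof (rule max[OF subgroup_adjoin[OF D(1) y] subset_adjoin(1)[OF D(1) y]], intro ballI)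
      fix a b assume ab: "a \<in> adjoin D ?y" "b \<in> adjoin D ?y"
      have "N a b = 1"
        using isotropic_adjoin[OF D(1) _ y yD ab] D(3) by blast
      moreover have "a = \<one>" if "a \<in> M"
        using adjoin_Int_trivial[OF D(1) M(1) DM y] yn ab(1) that unfolding comm by blast
      ultimately show "?Q a b" by blast
    qed
    then have "?y \<in> D" using subset_adjoin(2)[OF D(1) y] by simp
    then show False using yn subset_set_mult(2)[OF M(1) D(1)] by blast
  qed
  then have "M <#> D = carrier L"
    using subgroup.subset[OF mult_subgroups[OF M(1) D(1)]] by blast
  then show ?thesis using that D MD by blast
qed

end

subsection \<open>Splitting off a discrete Lagrangian\<close>

text \<open>When \<open>D\<close> is a subgroup meeting some open subgroup trivially, the discrete
  topology is the one it inherits from the ambient group.\<close>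

definition discrete_tgroup :: "('a, 'b) monoid_scheme \<Rightarrow> 'a set \<Rightarrow> 'a tgroup" where
  "discrete_tgroup G D = \<lparr>carrier = D, mult = mult G, one = one G, gtop = discrete_topology D\<rparr>"

lemma discrete_tgroup_sel [simp]:
  "carrier (discrete_tgroup G D) = D" "mult (discrete_tgroup G D) = mult G"
  "one (discrete_tgroup G D) = one G" "gtop (discrete_tgroup G D) = discrete_topology D"
  by (simp_all add: discrete_tgroup_def)

lemma (in comm_group) LCA_discrete_tgroup:
  assumes D: "subgroup D G"
  shows "LCA (discrete_tgroup G D)"
proof -
  have car: "d \<in> carrier G" if "d \<in> D" for d using that D subgroup.mem_carrier by metis
  interpret A: comm_group "discrete_tgroup G D"
  proof (rule comm_groupI)
    fix x assume "x \<in> carrier (discrete_tgroup G D)"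
    then show "\<exists>y\<in>carrier (discrete_tgroup G D).
        y \<otimes>\<^bsub>discrete_tgroup G D\<^esub> x = \<one>\<^bsub>discrete_tgroup G D\<^esub>"
      using car subgroup.m_inv_closed[OF D] by (auto intro!: bexI[of _ "inv x"])
  qed (use car D in \<open>auto simp: subgroup.m_closed subgroup.one_closed m_ac\<close>)
  have "continuous_map (prod_topology (discrete_topology D) (discrete_topology D))
      (discrete_topology D) (\<lambda>(x, y). x \<otimes> y)"
    unfolding prod_topology_discrete_topology[symmetric]
    using D by (auto simp: subgroup.m_closed)
  moreover have "(\<lambda>x. inv\<^bsub>discrete_tgroup G D\<^esub> x) \<in> D \<rightarrow> D"
    using A.inv_closed by auto
  ultimately show ?thesis
    using A.comm_group_axioms
    by (simp add: LCA_def Hausdorff_space_discrete_topology locally_compact_space_discrete_topology)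
qed

section \<open>The isomorphism with the product of the discrete complement and its dual\<close>

context symplectic_p_group
begin

text \<open>Compact subsets of the discrete group are finite, hence compact in \<open>L\<close> too,
  so subbasic conditions on the restriction are subbasic conditions on \<open>N x\<close>.\<close>

lemma continuous_map_restrict_N:
  assumes D: "subgroup D L"
  shows "continuous_map (gtop L) (compact_open (discrete_tgroup L D)) (\<lambda>x. restrict (N x) D)"
proof (rule continuous_map_compact_openI)
  have car: "d \<in> carrier L" if "d \<in> D" for d using that D subgroup.mem_carrier by metis
  show "restrict (N x) D \<in> characters (discrete_tgroup L D)" if "x \<in> topspace (gtop L)" for x
    using that car D
    by (intro charactersI) (auto simp: N_mult_right subgroup.m_closed)
  fix K U assume K: "compactin (gtop (discrete_tgroup L D)) K" and U: "openin (gtop Tgrp) U"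
  have "finite K" "K \<subseteq> D" using K by (simp_all add: compactin_discrete_topology)
  then have "compactin (gtop L) K" using car by (auto intro!: finite_imp_compactin)
  from openin_continuous_map_preimage[OF homeomorphic_imp_continuous_map[OF N_homeo]
      openin_compact_open_basic[OF this U]]
  have "openin (gtop L) {x \<in> carrier L. N x \<in> {f \<in> characters L. f ` K \<subseteq> U}}" by simp
  moreover have "{x \<in> carrier L. N x \<in> {f \<in> characters L. f ` K \<subseteq> U}} =
      {x \<in> topspace (gtop L). restrict (N x) D ` K \<subseteq> U}"
    using \<open>K \<subseteq> D\<close> by (auto simp: N_char image_subset_iff subset_iff)
  ultimately show "openin (gtop L) {x \<in> topspace (gtop L). restrict (N x) D ` K \<subseteq> U}" by simp
qed

lemma standard: "standard L N"
proof -
  obtain M where M: "subgroup M L" "openin (gtop L) M" "perp M = M"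
    using open_Lagrangian by blast
  obtain D where D: "subgroup D L" "\<And>a b. a \<in> D \<Longrightarrow> b \<in> D \<Longrightarrow> N a b = 1"
    "M \<inter> D = {\<one>}" "M <#> D = carrier L"
    using Lagrangian_complement[OF M] by blast
  obtain \<pi> where \<pi>: "\<pi> \<in> hom L L" "\<And>x. x \<in> carrier L \<Longrightarrow> \<pi> x \<in> D"
      "\<And>x. x \<in> carrier L \<Longrightarrow> x \<otimes> inv (\<pi> x) \<in> M"
      "\<And>c d. c \<in> M \<Longrightarrow> d \<in> D \<Longrightarrow> \<pi> (c \<otimes> d) = d"
    using internal_projection[OF M(1) D(1) D(3,4)] by metis
  \<comment> \<open>The continuity of the inverse \<open>J\<close> of \<open>N\<close> will make the
    representing element depend continuously on the character.\<close>
  obtain J where J: "homeomorphic_maps (gtop L) (compact_open L) N J"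
    using N_homeo homeomorphic_map_maps by blast
  have Jcont: "continuous_map (compact_open L) (gtop L) J"
    and JN: "\<And>x. x \<in> carrier L \<Longrightarrow> J (N x) = x" and NJ: "\<And>c. c \<in> characters L \<Longrightarrow> N (J c) = c"
    using J by (auto simp: homeomorphic_maps_def)
  have Dcar: "d \<in> carrier L" if "d \<in> D" for d using that D(1) subgroup.mem_carrier by metis
  have Mcar: "m \<in> carrier L" if "m \<in> M" for m using that M(1) subgroup.mem_carrier by metis
  have Miso: "N a b = 1" if "a \<in> M" "b \<in> M" for a b
    using that M(3) by (auto simp: perp_def)
  have \<pi>D: "\<pi> d = d" if "d \<in> D" for d
    using \<pi>(4)[OF subgroup.one_closed[OF M(1)] that] Dcar[OF that] by simp
  have \<pi>M: "\<pi> m = \<one>" if "m \<in> M" for m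
    using \<pi>(4)[OF that subgroup.one_closed[OF D(1)]] Mcar[OF that] by simp
  have \<pi>c: "\<pi> x \<in> carrier L" if "x \<in> carrier L" for x using Dcar \<pi>(2) that by blast
  have split: "x = (x \<otimes> inv (\<pi> x)) \<otimes> \<pi> x" if "x \<in> carrier L" for x
    using that \<pi>c by (simp add: m_assoc)
  define A where "A = discrete_tgroup L D"
  have Asel [simp]: "carrier A = D" "mult A = mult L" "gtop A = discrete_topology D"
    by (simp_all add: A_def)
  have LCA_A: "LCA A" unfolding A_def using LCA_discrete_tgroup[OF D(1)] .
  \<comment> \<open>Extension of a character of \<open>D\<close> to \<open>L\<close>, trivially on
    \<open>M\<close>.\<close>
  define e where "e = (\<lambda>c. \<lambda>x\<in>carrier L. (c :: 'a \<Rightarrow> complex) (\<pi> x))"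
  have Achar: "cmod (c d) = 1" "c (d \<otimes> d') = c d * c d'" "c \<one> = 1" "c \<in> extensional D"
    if "c \<in> characters A" "d \<in> D" "d' \<in> D" for c d d'
  proof -
    have one: "\<one> \<in> D" using D(1) subgroup.one_closed by blast
    show "cmod (c d) = 1" "c (d \<otimes> d') = c d * c d'" "c \<in> extensional D"
      using charactersD[OF that(1)] that by auto
    have "c \<one> = c \<one> * c \<one>" "cmod (c \<one>) = 1"
      using charactersD(1,2)[OF that(1)] one by force+
    then show "c \<one> = 1" by (metis mult_cancel_left1 norm_zero zero_neq_one)
  qed
  have e_char: "e c \<in> characters L" if "c \<in> characters A" for c
    unfolding e_def
    by (rule character_if_trivial_on_open[OF LCA_L M(2,1)])
      (use Achar[OF that] \<pi>(2) \<pi>M subgroup.one_closed[OF D(1)] in \<open>auto simp: hom_mult[OF \<pi>(1)]\<close>)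
  \<comment> \<open>The element representing \<open>e c\<close>; it lies in \<open>M\<close> because
    \<open>e c\<close> is trivial on \<open>M\<close>.\<close>
  define m where "m = (\<lambda>c. J (e c))"
  have Nm: "N (m c) = e c" if "c \<in> characters A" for c
    using NJ e_char that by (simp add: m_def)
  have mM: "m c \<in> M" if c: "c \<in> characters A" for c
  proof -
    have "e c x = 1" if "x \<in> M" for x
      using that Mcar \<pi>M Achar(3)[OF c subgroup.one_closed[OF D(1)] subgroup.one_closed[OF D(1)]]
      by (simp add: e_def)
    then obtain m' where "m' \<in> M" "N m' = e c"
      using Lagrangian_represents[OF M(3) e_char[OF c]] by blast
    then show ?thesis using JN Mcar by (metis m_def)
  qed
  have Nm_D: "N (m c) d = c d" if "c \<in> characters A" "d \<in> D" for c d
    using Nm that \<pi>D Dcar by (simp add: e_def)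
  define \<phi> where "\<phi> = (\<lambda>(d, c). d \<otimes> m c)"
  \<comment> \<open>The inverse of \<open>\<phi>\<close>: split \<open>z\<close> into its components
    in \<open>D\<close> and \<open>M\<close>, and turn the \<open>M\<close>-component into the
    character of \<open>D\<close> that it induces.\<close>
  define \<psi> where "\<psi> = (\<lambda>z. (\<pi> z, restrict (N (z \<otimes> inv (\<pi> z))) D))"
  have \<pi>cont: "continuous_map (gtop L) (discrete_topology D) \<pi>"
    by (rule continuous_map_if_open_periods[OF LCA_L M(2,1)])
      (use \<pi>(2) \<pi>M \<pi>c Mcar in \<open>auto simp: hom_mult[OF \<pi>(1)]\<close>)
  have Dcont: "continuous_map (discrete_topology D) (gtop L) (\<lambda>x. x)"
    using Dcar by auto
  have inv_cont: "continuous_map (gtop L) (gtop L) (\<lambda>x. inv x)"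
    using LCA_L by (simp add: LCA_def)
  have e_cont: "continuous_map (compact_open A) (compact_open L) e"
  proof (rule continuous_map_compact_openI)
    show "e c \<in> characters L" if "c \<in> topspace (compact_open A)" for c using e_char that by simp
    fix K U assume K: "compactin (gtop L) K" and U: "openin (gtop Tgrp) U"
    have "K \<subseteq> carrier L" using compactin_subset_topspace[OF K] by simp
    then have "{c \<in> topspace (compact_open A). e c ` K \<subseteq> U} = {c \<in> characters A. c ` (\<pi> ` K) \<subseteq> U}"
      by (auto simp: e_def image_subset_iff subset_iff)
    moreover have "compactin (gtop A) (\<pi> ` K)"
      using image_compactin[OF K \<pi>cont] by simp
    ultimately show "openin (compact_open A) {c \<in> topspace (compact_open A). e c ` K \<subseteq> U}"
      using openin_compact_open_basic[OF _ U, of A] by simp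
  qed
  have homeo: "homeomorphic_maps (prod_topology (discrete_topology D) (compact_open A)) (gtop L) \<phi> \<psi>"
    unfolding homeomorphic_maps_def
  proof (intro conjI ballI)
    have "continuous_map (compact_open A) (gtop L) m"
      using continuous_map_compose[OF e_cont Jcont] by (simp add: m_def o_def)
    then show "continuous_map (prod_topology (discrete_topology D) (compact_open A)) (gtop L) \<phi>"
      unfolding \<phi>_def case_prod_unfold
      using continuous_map_compose[OF continuous_map_fst Dcont]
        continuous_map_compose[OF continuous_map_snd]
      by (intro continuous_map_mult[OF LCA_L]) (simp_all add: o_def)
    have "continuous_map (gtop L) (gtop L) (\<lambda>z. z \<otimes> inv (\<pi> z))"
      using continuous_map_compose[OF continuous_map_compose[OF \<pi>cont Dcont] inv_cont]
      by (intro continuous_map_mult[OF LCA_L]) (simp_all add: o_def)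
    from continuous_map_compose[OF this continuous_map_restrict_N[OF D(1)]]
    show "continuous_map (gtop L) (prod_topology (discrete_topology D) (compact_open A)) \<psi>"
      unfolding \<psi>_def A_def using \<pi>cont by (intro continuous_map_pairedI) (simp_all add: o_def)
  next
    fix u assume "u \<in> topspace (prod_topology (discrete_topology D) (compact_open A))"
    then obtain d c where u: "u = (d, c)" "d \<in> D" "c \<in> characters A" by auto
    have "\<pi> (d \<otimes> m c) = d"
      using \<pi>(4)[OF mM[OF u(3)] u(2)] u Dcar Mcar mM by (simp add: m_comm)
    moreover have "d \<otimes> m c \<otimes> inv d = m c"
      using u Dcar Mcar[OF mM[OF u(3)]] by (simp add: m_comm m_assoc[symmetric])
    moreover have "restrict (N (m c)) D = c"
      using Nm_D[OF u(3)] Achar(4)[OF u(3,2,2)] by (intro extensionalityI[of _ D]) auto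
    ultimately show "\<psi> (\<phi> u) = u" by (simp add: \<phi>_def \<psi>_def u)
  next
    fix z assume "z \<in> topspace (gtop L)"
    then have z: "z \<in> carrier L" by simp
    let ?m = "z \<otimes> inv (\<pi> z)"
    have m: "?m \<in> M" "?m \<in> carrier L" using \<pi>(3) z Mcar by auto
    have c: "restrict (N ?m) D \<in> characters A"
      using continuous_map_restrict_N[OF D(1)] m(2)
      unfolding A_def continuous_map_def topspace_compact_open topspace_L by blast
    \<comment> \<open>Since \<open>M\<close> is isotropic, \<open>N ?m\<close> ignores the
      \<open>M\<close>-component of its argument and is determined by its values on
      \<open>D\<close>.\<close>
    have "e (restrict (N ?m) D) = N ?m"
    proof (rule extensionalityI[of _ "carrier L"])
      fix x assume x: "x \<in> carrier L"
      have "N ?m x = N ?m ((x \<otimes> inv (\<pi> x)) \<otimes> \<pi> x)" using split[OF x] by simp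
      also have "\<dots> = N ?m (x \<otimes> inv (\<pi> x)) * N ?m (\<pi> x)"
        using m x \<pi>c by (intro N_mult_right) auto
      also have "\<dots> = N ?m (\<pi> x)"
        using Miso[OF m(1) \<pi>(3)[OF x]] by simp
      finally show "e (restrict (N ?m) D) x = N ?m x"
        using x \<pi>(2) by (simp add: e_def)
    qed (use charactersD(3)[OF N_char[OF m(2)]] in \<open>auto simp: e_def\<close>)
    then have "m (restrict (N ?m) D) = ?m" using JN m(2) by (simp add: m_def)
    then show "\<phi> (\<psi> z) = z"
      using z \<pi>c split[OF z] m by (simp add: \<phi>_def \<psi>_def m_comm[of "\<pi> z"])
  qed
  have carr: "carrier (tprod A (dual A)) = D \<times> characters A"
    "gtop (tprod A (dual A)) = prod_topology (discrete_topology D) (compact_open A)"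
    by (simp_all add: tprod_def dual_def)
  have hm: "homeomorphic_map (prod_topology (discrete_topology D) (compact_open A)) (gtop L) \<phi>"
    using homeo homeomorphic_map_maps by blast
  have bij: "bij_betw \<phi> (D \<times> characters A) (carrier L)"
    using hm by (simp add: homeomorphic_eq_everything_map bij_betw_def)
  have "\<phi> \<in> hom (tprod A (dual A)) L"
  proof (rule homI)
    show "\<phi> u \<in> carrier L" if "u \<in> carrier (tprod A (dual A))" for u
      using that bij by (auto simp: carr bij_betw_def)
    fix u v assume "u \<in> carrier (tprod A (dual A))" "v \<in> carrier (tprod A (dual A))"
    then obtain d c d' c' where u: "u = (d, c)" "d \<in> D" "c \<in> characters A"
      and v: "v = (d', c')" "d' \<in> D" "c' \<in> characters A" by (auto simp: carr)
    let ?cc = "\<lambda>x\<in>D. c x * c' x"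
    have cc: "?cc \<in> characters A"
      by (rule charactersI)
        (use Achar[OF u(3)] Achar[OF v(3)] D(1) in \<open>auto simp: subgroup.m_closed norm_mult\<close>)
    have car: "d \<in> carrier L" "d' \<in> carrier L" "m c \<in> carrier L" "m c' \<in> carrier L" "m ?cc \<in> carrier L"
      using u v Dcar Mcar mM cc by blast+
    \<comment> \<open>Both sides represent the product of \<open>e c\<close> and
      \<open>e c'\<close>, and \<open>N\<close> is injective.\<close>
    have "m ?cc = m c \<otimes> m c'"
      by (rule N_eqI) (use car u v cc \<pi>(2) in \<open>auto simp: Nm N_mult_left e_def\<close>)
    then show "\<phi> (u \<otimes>\<^bsub>tprod A (dual A)\<^esub> v) = \<phi> u \<otimes> \<phi> v"
      using car by (simp add: tprod_def dual_def \<phi>_def u v m_ac)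
  qed
  then have iso: "\<phi> \<in> top_iso (tprod A (dual A)) L"
    using bij hm by (simp add: top_iso_def iso_def carr)
  have "N (\<phi> u) (\<phi> v) = std_nabla A u v"
    if "u \<in> carrier (tprod A (dual A))" "v \<in> carrier (tprod A (dual A))" for u v
  proof -
    obtain d c d' c' where u: "u = (d, c)" "d \<in> D" "c \<in> characters A"
      and v: "v = (d', c')" "d' \<in> D" "c' \<in> characters A" using \<open>u \<in> _\<close> \<open>v \<in> _\<close> by (auto simp: carr)
    have car: "d \<in> carrier L" "d' \<in> carrier L" "m c \<in> carrier L" "m c' \<in> carrier L"
      using u v Dcar Mcar mM by blast+
    \<comment> \<open>Isotropy of \<open>D\<close> and of \<open>M\<close> removes the first and
      last factors; the mixed ones evaluate \<open>c\<close> at \<open>d'\<close> and, through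
      antisymmetry, the inverse of \<open>c'\<close> at \<open>d\<close>.\<close>
    have "N (\<phi> u) (\<phi> v) = N d d' * N d (m c') * (N (m c) d' * N (m c) (m c'))"
      using car by (simp add: \<phi>_def u v N_mult_left N_mult_right)
    also have "N d (m c') = inverse (c' d)"
      using N_swap[OF car(4,1)] Nm_D u v by simp
    finally show ?thesis
      using D(2) Miso mM Nm_D u v by (simp add: std_nabla_def)
  qed
  then show ?thesis unfolding standard_def using LCA_A iso by blast
qed

end

theorem theorem4p5:
  fixes p :: nat and L :: "'a tgroup" and N :: "'a \<Rightarrow> 'a \<Rightarrow> complex"
  assumes "prime p"
    and "LCA L"
    and "\<forall>x\<in>carrier L. x [^]\<^bsub>L\<^esub> p = \<one>\<^bsub>L\<^esub>"
    and "symplectic_self_duality L N"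
  shows "standard L N"
proof -
  interpret comm_group L using assms(2) by (simp add: LCA_def)
  interpret symplectic_p_group L p N
    by unfold_locales (use assms in auto)
  show ?thesis by (rule standard)
qed

end
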